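(* Every quotient divisible group of rank 1 is an $RAI$-group, an $RFI$-group and an $afi$-group.
   Context: All groups are abelian, written additively. A group $G$ is quotient divisible if it contains no nonzero divisible torsion subgroup but contains a free subgroup $F$ of finite rank such that $G/F$ is a divisible torsion group; "rank 1" means torsion-free rank 1 (equivalently, $F$ has rank 1). A multiplication on $G$ is a homomorphism $\mu:G\otimes G\to G$, written $g_1\times g_2=\mu(g_1\otimes g_2)$; a ring on $G$ is $G$ equipped with a multiplication (associativity, commutativity and a unit are not required). An absolute ideal of $G$ is a subgroup of $G$ that is an ideal in every ring on $G$. A subgroup is fully invariant if it is mapped into itself by every endomorphism of $G$. A ring $R$ is an $AI$-ring (respectively, an $FI$-ring) if every ideal of $R$ is an absolute ideal (respectively, a fully invariant subgroup) of the additive group of $R$. A group is an $RAI$-group (respectively, an $RFI$-group) if there exists at least one $AI$-ring (respectively, $FI$-ring) on it. A group is an $afi$-group if each of its absolute ideals is a fully invariant subgroup. *)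

theory Defs
  imports "HOL-Algebra.Free_Abelian_Groups" "HOL-Library.Extended_Nat"
begin

text \<open>
  Abelian groups are rendered as \<open>comm_group\<close>, whose operations are written multiplicatively;
  \<open>x [^]\<^bsub>G\<^esub> n\<close> is the multiple \<open>n x\<close> and \<open>\<one>\<^bsub>G\<^esub>\<close> is the zero element of the additive notation.
\<close>


section \<open>Quotient divisible groups and torsion-free rank\<close>

definition divisible_group :: "('a, 'm) monoid_scheme \<Rightarrow> bool" where
  "divisible_group G \<longleftrightarrow>
     (\<forall>n::nat. \<forall>x\<in>carrier G. 0 < n \<longrightarrow> (\<exists>y\<in>carrier G. y [^]\<^bsub>G\<^esub> n = x))"

definition torsion_group :: "('a, 'm) monoid_scheme \<Rightarrow> bool" where
  "torsion_group G \<longleftrightarrow> (\<forall>x\<in>carrier G. \<exists>n::nat. 0 < n \<and> x [^]\<^bsub>G\<^esub> n = \<one>\<^bsub>G\<^esub>)"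

definition free_of_rank :: "('a, 'm) monoid_scheme \<Rightarrow> nat \<Rightarrow> bool" where
  "free_of_rank G n \<longleftrightarrow> G \<cong> free_Abelian_group {..<n}"

definition quotient_divisible :: "('a, 'm) monoid_scheme \<Rightarrow> bool" where
  "quotient_divisible G \<longleftrightarrow>
     (\<forall>D. subgroup D G \<and> divisible_group (G\<lparr>carrier := D\<rparr>) \<and> torsion_group (G\<lparr>carrier := D\<rparr>)
          \<longrightarrow> D = {\<one>\<^bsub>G\<^esub>}) \<and>
     (\<exists>F n. subgroup F G \<and> free_of_rank (G\<lparr>carrier := F\<rparr>) n \<and>
            divisible_group (G Mod F) \<and> torsion_group (G Mod F))"

definition int_independent :: "('a, 'm) monoid_scheme \<Rightarrow> 'a set \<Rightarrow> bool" where
  "int_independent G S \<longleftrightarrow> finite S \<and> S \<subseteq> carrier G \<and>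
     (\<forall>c :: 'a \<Rightarrow> int. finprod G (\<lambda>x. x [^]\<^bsub>G\<^esub> c x) S = \<one>\<^bsub>G\<^esub> \<longrightarrow> (\<forall>x\<in>S. c x = 0))"

text \<open>Infinite cardinal ranks are not distinguished: they all give \<open>\<infinity>\<close>.\<close>

definition torsion_free_rank :: "('a, 'm) monoid_scheme \<Rightarrow> enat" where
  "torsion_free_rank G = (SUP S \<in> {S. int_independent G S}. enat (card S))"


section \<open>Tensor products\<close>

text \<open>
  The tensor product is the free abelian group on \<open>carrier G \<times> carrier H\<close> modulo the subgroup
  generated by the bilinearity relations. The group operation of \<open>free_Abelian_group\<close> is \<open>+\<close>
  on finitely supported integer-valued functions.
\<close>

definition tensor_relations ::
    "('a, 'm) monoid_scheme \<Rightarrow> ('b, 'n) monoid_scheme \<Rightarrow> ('a \<times> 'b \<Rightarrow>\<^sub>0 int) set" where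
  "tensor_relations G H =
     {frag_of (x \<otimes>\<^bsub>G\<^esub> x', y) - frag_of (x, y) - frag_of (x', y) | x x' y.
        x \<in> carrier G \<and> x' \<in> carrier G \<and> y \<in> carrier H} \<union>
     {frag_of (x, y \<otimes>\<^bsub>H\<^esub> y') - frag_of (x, y) - frag_of (x, y') | x y y'.
        x \<in> carrier G \<and> y \<in> carrier H \<and> y' \<in> carrier H}"

definition tensor_kernel ::
    "('a, 'm) monoid_scheme \<Rightarrow> ('b, 'n) monoid_scheme \<Rightarrow> ('a \<times> 'b \<Rightarrow>\<^sub>0 int) set" where
  "tensor_kernel G H =
     generate (free_Abelian_group (carrier G \<times> carrier H)) (tensor_relations G H)"

definition tensor_product ::
    "('a, 'm) monoid_scheme \<Rightarrow> ('b, 'n) monoid_scheme \<Rightarrow> ('a \<times> 'b \<Rightarrow>\<^sub>0 int) set monoid" where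
  "tensor_product G H = free_Abelian_group (carrier G \<times> carrier H) Mod tensor_kernel G H"

definition pure_tensor ::
    "('a, 'm) monoid_scheme \<Rightarrow> ('b, 'n) monoid_scheme \<Rightarrow> 'a \<Rightarrow> 'b \<Rightarrow> ('a \<times> 'b \<Rightarrow>\<^sub>0 int) set" where
  "pure_tensor G H x y =
     tensor_kernel G H #>\<^bsub>free_Abelian_group (carrier G \<times> carrier H)\<^esub> frag_of (x, y)"


section \<open>Rings on a group and their ideals\<close>

text \<open>
  A ring on \<open>G\<close> is represented by its multiplication \<open>\<mu>\<close>; it need not be associative,
  commutative or unital.
\<close>

type_synonym 'a multiplication = "('a \<times> 'a \<Rightarrow>\<^sub>0 int) set \<Rightarrow> 'a"

definition multiplications :: "('a, 'm) monoid_scheme \<Rightarrow> 'a multiplication set" where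
  "multiplications G = hom (tensor_product G G) G"

definition times_of :: "('a, 'm) monoid_scheme \<Rightarrow> 'a multiplication \<Rightarrow> 'a \<Rightarrow> 'a \<Rightarrow> 'a" where
  "times_of G \<mu> x y = \<mu> (pure_tensor G G x y)"

definition ring_ideal :: "('a, 'm) monoid_scheme \<Rightarrow> 'a multiplication \<Rightarrow> 'a set \<Rightarrow> bool" where
  "ring_ideal G \<mu> I \<longleftrightarrow> subgroup I G \<and>
     (\<forall>a\<in>I. \<forall>g\<in>carrier G. times_of G \<mu> a g \<in> I \<and> times_of G \<mu> g a \<in> I)"

definition absolute_ideal :: "('a, 'm) monoid_scheme \<Rightarrow> 'a set \<Rightarrow> bool" where
  "absolute_ideal G A \<longleftrightarrow> subgroup A G \<and> (\<forall>\<mu>\<in>multiplications G. ring_ideal G \<mu> A)"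

definition fully_invariant :: "('a, 'm) monoid_scheme \<Rightarrow> 'a set \<Rightarrow> bool" where
  "fully_invariant G A \<longleftrightarrow> subgroup A G \<and> (\<forall>\<phi>\<in>hom G G. \<phi> ` A \<subseteq> A)"

definition AI_ring :: "('a, 'm) monoid_scheme \<Rightarrow> 'a multiplication \<Rightarrow> bool" where
  "AI_ring G \<mu> \<longleftrightarrow> \<mu> \<in> multiplications G \<and> (\<forall>I. ring_ideal G \<mu> I \<longrightarrow> absolute_ideal G I)"

definition FI_ring :: "('a, 'm) monoid_scheme \<Rightarrow> 'a multiplication \<Rightarrow> bool" where
  "FI_ring G \<mu> \<longleftrightarrow> \<mu> \<in> multiplications G \<and> (\<forall>I. ring_ideal G \<mu> I \<longrightarrow> fully_invariant G I)"

definition RAI_group :: "('a, 'm) monoid_scheme \<Rightarrow> bool" where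
  "RAI_group G \<longleftrightarrow> (\<exists>\<mu>. AI_ring G \<mu>)"

definition RFI_group :: "('a, 'm) monoid_scheme \<Rightarrow> bool" where
  "RFI_group G \<longleftrightarrow> (\<exists>\<mu>. FI_ring G \<mu>)"

definition afi_group :: "('a, 'm) monoid_scheme \<Rightarrow> bool" where
  "afi_group G \<longleftrightarrow> (\<forall>A. absolute_ideal G A \<longrightarrow> fully_invariant G A)"


section \<open>Multiplications and biadditive maps\<close>

lemma tensor_relations_subset:
  assumes "comm_group G" "comm_group H"
  shows "tensor_relations G H \<subseteq> carrier (free_Abelian_group (carrier G \<times> carrier H))"
proof -
  interpret G: comm_group G by fact
  interpret H: comm_group H by fact
  have "frag_of p - frag_of q - frag_of r \<in> carrier (free_Abelian_group X)"
    if "p \<in> X" "q \<in> X" "r \<in> X" for p q r :: "'a \<times> 'c" and X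
    using that keys_diff[of "frag_of p - frag_of q" "frag_of r"] keys_diff[of "frag_of p" "frag_of q"]
    by auto
  then show ?thesis
    unfolding tensor_relations_def
    by (intro Un_least subsetI; elim CollectE exE conjE) (simp only: mem_Sigma_iff G.m_closed H.m_closed)+
qed

lemma tensor_kernel_normal:
  assumes "comm_group G" "comm_group H"
  shows "tensor_kernel G H \<lhd> free_Abelian_group (carrier G \<times> carrier H)"
proof -
  interpret A: comm_group "free_Abelian_group (carrier G \<times> carrier H)"
    by (rule abelian_free_Abelian_group)
  show ?thesis
    unfolding tensor_kernel_def
    by (intro A.subgroup_imp_normal A.generate_is_subgroup tensor_relations_subset assms)
qed

lemma pure_tensor_bilinear:
  assumes "comm_group G" "comm_group H"
  shows "\<lbrakk>x \<in> carrier G; y \<in> carrier H\<rbrakk> \<Longrightarrow> pure_tensor G H x y \<in> carrier (tensor_product G H)"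
    and "\<lbrakk>x \<in> carrier G; x' \<in> carrier G; y \<in> carrier H\<rbrakk> \<Longrightarrow>
      pure_tensor G H (x \<otimes>\<^bsub>G\<^esub> x') y =
        pure_tensor G H x y \<otimes>\<^bsub>tensor_product G H\<^esub> pure_tensor G H x' y"
    and "\<lbrakk>x \<in> carrier G; y \<in> carrier H; y' \<in> carrier H\<rbrakk> \<Longrightarrow>
      pure_tensor G H x (y \<otimes>\<^bsub>H\<^esub> y') =
        pure_tensor G H x y \<otimes>\<^bsub>tensor_product G H\<^esub> pure_tensor G H x y'"
proof -
  interpret G: comm_group G by fact
  interpret H: comm_group H by fact
  let ?A = "free_Abelian_group (carrier G \<times> carrier H)"
  interpret A: comm_group ?A by (rule abelian_free_Abelian_group)
  interpret N: normal "tensor_kernel G H" ?A by (rule tensor_kernel_normal[OF assms])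
  have eq: "tensor_kernel G H #>\<^bsub>?A\<^esub> a = (tensor_kernel G H #>\<^bsub>?A\<^esub> b) <#>\<^bsub>?A\<^esub> (tensor_kernel G H #>\<^bsub>?A\<^esub> c)"
    if "a \<in> carrier ?A" "b \<in> carrier ?A" "c \<in> carrier ?A" "a - b - c \<in> tensor_relations G H" for a b c
  proof -
    have "a - b - c \<in> tensor_kernel G H"
      unfolding tensor_kernel_def by (rule generate.incl) fact
    moreover have bc: "b + c \<in> carrier ?A"
      using A.m_closed[OF that(2,3)] by simp
    ultimately have "a \<in> tensor_kernel G H #>\<^bsub>?A\<^esub> (b + c)"
      unfolding r_coset_def by (auto intro!: bexI[of _ "a - b - c"])
    then have "tensor_kernel G H #>\<^bsub>?A\<^esub> (b + c) = tensor_kernel G H #>\<^bsub>?A\<^esub> a"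
      by (rule A.repr_independence[OF _ bc N.subgroup_axioms])
    then show ?thesis
      using N.rcos_sum[OF that(2,3)] by simp
  qed
  show "pure_tensor G H x y \<in> carrier (tensor_product G H)"
    if "x \<in> carrier G" "y \<in> carrier H"
    using that unfolding pure_tensor_def tensor_product_def FactGroup_def RCOSETS_def by auto
  show "pure_tensor G H (x \<otimes>\<^bsub>G\<^esub> x') y =
        pure_tensor G H x y \<otimes>\<^bsub>tensor_product G H\<^esub> pure_tensor G H x' y"
    if "x \<in> carrier G" "x' \<in> carrier G" "y \<in> carrier H"
    unfolding pure_tensor_def tensor_product_def FactGroup_def monoid.simps
    by (rule eq) (use that in \<open>auto simp: tensor_relations_def\<close>)
  show "pure_tensor G H x (y \<otimes>\<^bsub>H\<^esub> y') =
        pure_tensor G H x y \<otimes>\<^bsub>tensor_product G H\<^esub> pure_tensor G H x y'"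
    if "x \<in> carrier G" "y \<in> carrier H" "y' \<in> carrier H"
    unfolding pure_tensor_def tensor_product_def FactGroup_def monoid.simps
    by (rule eq) (use that in \<open>auto simp: tensor_relations_def\<close>)
qed

definition biadditive :: "('a, 'm) monoid_scheme \<Rightarrow> ('a \<Rightarrow> 'a \<Rightarrow> 'a) \<Rightarrow> bool" where
  "biadditive G f \<longleftrightarrow>
     (\<forall>x\<in>carrier G. f x \<in> hom G G) \<and> (\<forall>y\<in>carrier G. (\<lambda>x. f x y) \<in> hom G G)"

lemma biadditive_times_of:
  assumes "comm_group G" "\<mu> \<in> multiplications G"
  shows "biadditive G (times_of G \<mu>)"
  using assms(2) pure_tensor_bilinear[OF assms(1) assms(1)]
  unfolding biadditive_def times_of_def multiplications_def by (auto simp: hom_def)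

lemma biadditive_imp_multiplication:
  fixes G :: "('a, 'm) monoid_scheme"
  assumes "comm_group G" "biadditive G f"
  obtains \<mu> where "\<mu> \<in> multiplications G"
    "\<And>x y. \<lbrakk>x \<in> carrier G; y \<in> carrier G\<rbrakk> \<Longrightarrow> times_of G \<mu> x y = f x y"
proof -
  interpret G: comm_group G by fact
  let ?A = "free_Abelian_group (carrier G \<times> carrier G)"
  interpret A: comm_group ?A by (rule abelian_free_Abelian_group)
  have f1: "f x y \<in> carrier G" if "x \<in> carrier G" "y \<in> carrier G" for x y
    using assms(2) that by (auto simp: biadditive_def hom_def)
  have f2: "f (x \<otimes>\<^bsub>G\<^esub> x') y = f x y \<otimes>\<^bsub>G\<^esub> f x' y"
    if "x \<in> carrier G" "x' \<in> carrier G" "y \<in> carrier G" for x x' y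
    using assms(2) that by (auto simp: biadditive_def hom_def)
  have f3: "f x (y \<otimes>\<^bsub>G\<^esub> y') = f x y \<otimes>\<^bsub>G\<^esub> f x y'"
    if "x \<in> carrier G" "y \<in> carrier G" "y' \<in> carrier G" for x y y'
    using assms(2) that by (auto simp: biadditive_def hom_def)
  have "case_prod f ` (carrier G \<times> carrier G) \<subseteq> carrier G"
    using f1 by auto
  then obtain h where h: "h \<in> hom ?A G"
    and hf: "\<And>p. p \<in> carrier G \<times> carrier G \<Longrightarrow> h (frag_of p) = case_prod f p"
    by (rule G.free_Abelian_group_universal) blast
  interpret h: group_hom ?A G h
    using h by unfold_locales
  have hd: "h (a - b - c) = \<one>\<^bsub>G\<^esub>"
    if "a \<in> carrier ?A" "b \<in> carrier ?A" "c \<in> carrier ?A" "h a = h b \<otimes>\<^bsub>G\<^esub> h c" for a b c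
  proof -
    have "a - b - c = a \<otimes>\<^bsub>?A\<^esub> inv\<^bsub>?A\<^esub> (b \<otimes>\<^bsub>?A\<^esub> c)"
      using that(2,3) A.m_closed[OF that(2,3)] by simp
    then show ?thesis
      using that by (simp only: h.hom_mult h.hom_inv A.m_closed A.inv_closed h.hom_closed G.m_closed G.r_inv)
  qed
  have "tensor_relations G G \<subseteq> kernel ?A G h"
  proof
    fix r assume r: "r \<in> tensor_relations G G"
    moreover have "h r = \<one>\<^bsub>G\<^esub>"
      using r unfolding tensor_relations_def
      by (auto intro!: hd simp: hf f2 f3)
    ultimately show "r \<in> kernel ?A G h"
      using tensor_relations_subset[OF assms(1,1)] unfolding kernel_def by blast
  qed
  then have "tensor_kernel G G \<subseteq> kernel ?A G h"
    unfolding tensor_kernel_def by (rule A.generate_subgroup_incl[OF _ h.subgroup_kernel])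
  then obtain \<mu> where \<mu>: "\<mu> \<in> hom (?A Mod tensor_kernel G G) G"
    "\<And>a. a \<in> carrier ?A \<Longrightarrow> \<mu> (tensor_kernel G G #>\<^bsub>?A\<^esub> a) = h a"
    using h.FactGroup_universal_kernel[OF tensor_kernel_normal[OF assms(1,1)]] by metis
  show thesis
  proof
    show "\<mu> \<in> multiplications G"
      using \<mu>(1) by (simp add: multiplications_def tensor_product_def)
    show "times_of G \<mu> x y = f x y" if "x \<in> carrier G" "y \<in> carrier G" for x y
      using that by (simp add: times_of_def pure_tensor_def \<mu>(2) hf)
  qed
qed

end

theory Submission
  imports Defs "HOL-Computational_Algebra.Primes"
begin

text \<open>
  The reason for the theorem is that a quotient divisible group \<open>G\<close> of rank 1 carries a ring with
  an identity element \<open>e\<close> whose right multiplications are exactly the endomorphisms of \<open>G\<close>: the free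
  subgroup with divisible torsion quotient is infinite cyclic, and \<open>e\<close> is a generator of it. Ideals
  of this ring are then stable under all endomorphisms (\<open>FI_ring_obtain\<close>). Since multiplication by a
  fixed element, in any ring on \<open>G\<close>, is an endomorphism, fully invariant subgroups are absolute
  ideals. So for subgroups of \<open>G\<close> the properties of being an ideal of the one ring, an absolute ideal
  and a fully invariant subgroup coincide, which gives all three claims at once.

  The ring is found as follows, in additive notation. Write \<open>u \<equiv> v (mod N)\<close> for \<open>u - v \<in> N G\<close>.
  Every \<open>x\<close> satisfies \<open>n x = m e\<close> for some integers \<open>n > 0\<close> and \<open>m\<close>, because \<open>G / \<langle>e\<rangle>\<close> is
  torsion, and is congruent to a multiple of \<open>e\<close> modulo every \<open>N > 0\<close>, because \<open>G / \<langle>e\<rangle>\<close> is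
  divisible. An element is therefore described by a rational number \<open>m / n\<close> together with a
  compatible family of residues, and products can be taken in both descriptions. The predicate
  \<open>is_product\<close> says that \<open>z\<close> has the descriptions expected of the product of \<open>x\<close> and \<open>y\<close>: they are
  \<open>n z = m y\<close>, and \<open>z \<equiv> a x (mod N)\<close> whenever \<open>y \<equiv> a e (mod N)\<close>. A product exists:
  with \<open>y = k e + n v\<close>, the element \<open>m v + k x\<close> will do.

  Two products of the same elements differ by a torsion element that lies in every \<open>N G\<close>, and
  the only such element is \<open>0\<close> (\<open>torsion_infinite_height_eq_one\<close>). This is where the absence of
  divisible torsion subgroups enters: since \<open>G / p G\<close> is generated by the image of \<open>e\<close>, the
  \<open>p\<close>-primary part \<open>T\<close> of \<open>G\<close> satisfies \<open>T = \<langle>t\<rangle> + p T\<close> for some \<open>t\<close>, so some \<open>p^k T\<close> is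
  divisible and hence zero.

  Uniqueness of products makes everything else formal. An endomorphism \<open>\<phi>\<close> preserves both descriptions,
  so \<open>\<phi> x\<close> is the product of \<open>x\<close> and \<open>\<phi> e\<close> (\<open>hom_eq_product\<close>); this also yields additivity in the
  second factor, by comparing endomorphisms at \<open>e\<close>.
\<close>

section \<open>Torsion elements of infinite height\<close>

text \<open>
  In a \<open>p\<close>-group, divisibility by \<open>p\<close> is all that has to be checked: an integer \<open>n\<close> prime to \<open>p\<close> is
  invertible modulo the order \<open>p^j\<close> of any element, and factors \<open>p\<close> of \<open>n\<close> are removed one by one.
\<close>
lemma (in comm_group) divisible_torsion_subgroupI:
  assumes H: "subgroup H G" and p: "prime (p::nat)"
    and tors: "\<And>s. s \<in> H \<Longrightarrow> \<exists>j. s [^] (int p ^ j) = \<one>"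
    and root: "\<And>s. s \<in> H \<Longrightarrow> \<exists>h\<in>H. s = h [^] int p"
  shows "divisible_group (G\<lparr>carrier := H\<rparr>)" and "torsion_group (G\<lparr>carrier := H\<rparr>)"
proof -
  interpret H: subgroup H G by fact
  have roots: "\<exists>h\<in>H. h [^] int n = s" if "s \<in> H" "0 < n" for s n
    using that
  proof (induction n arbitrary: s rule: less_induct)
    case (less n)
    show ?case
    proof (cases "p dvd n")
      case True
      then obtain m where m: "n = m * p" by (metis dvd_div_mult_self)
      obtain h where h: "h \<in> H" "s = h [^] int p" using root[OF less.prems(1)] by blast
      have "m < n" "0 < m" using m less.prems(2) prime_gt_1_nat[OF p] by auto
      from less.IH[OF this(1) h(1) this(2)] obtain g where g: "g \<in> H" "g [^] int m = h" by blast
      then have "g [^] int n = s"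
        using h m int_pow_pow[of g "int m" "int p"] by (simp add: H.mem_carrier)
      with g show ?thesis by blast
    next
      case False
      obtain j where j: "s [^] (int p ^ j) = \<one>" using tors[OF less.prems(1)] by blast
      have "coprime n p" using False p by (metis coprime_commute prime_imp_coprime)
      then have "coprime (int n) (int p ^ j)" by simp
      then obtain u v where uv: "u * int n + v * int p ^ j = 1"
        by (metis bezout_int coprime_iff_gcd_eq_1)
      have s: "s \<in> carrier G" using less.prems(1) by (rule H.mem_carrier)
      have "s = s [^] (u * int n + int p ^ j * v)" using uv s by (simp add: mult.commute)
      also have "\<dots> = (s [^] u) [^] int n \<otimes> (s [^] (int p ^ j)) [^] v"
        using s by (simp only: int_pow_mult int_pow_pow)
      also have "\<dots> = (s [^] u) [^] int n" using s j by simp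
      finally have "(s [^] u) [^] int n = s" by simp
      moreover have "s [^] u \<in> H" using H less.prems(1) by (rule subgroup_int_pow_closed)
      ultimately show ?thesis by blast
    qed
  qed
  have pow_H: "y [^]\<^bsub>G\<lparr>carrier := H\<rparr>\<^esub> n = y [^] int n" for y and n :: nat
    by (simp add: int_pow_int nat_pow_consistent[symmetric])
  show "divisible_group (G\<lparr>carrier := H\<rparr>)"
    using roots unfolding divisible_group_def pow_H by simp
  have "\<exists>n::nat. 0 < n \<and> s [^] int n = \<one>" if "s \<in> H" for s
    using tors[OF that] p prime_gt_0_nat by (metis of_nat_power zero_less_power)
  then show "torsion_group (G\<lparr>carrier := H\<rparr>)"
    unfolding torsion_group_def pow_H by simp
qed

text \<open>
  The properties of the generator \<open>e\<close> of a free subgroup witnessing that \<open>G\<close> is quotient divisible of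
  rank 1, stated without cosets: \<open>multiple_in_span\<close> expresses that \<open>G / \<langle>e\<rangle>\<close> is torsion and
  \<open>divisible_mod_span\<close> that it is divisible. Such an \<open>e\<close> turns out to be the identity element of a ring
  on \<open>G\<close>. Exponents are integers throughout, so that the laws of exponents hold without
  sign conditions.
\<close>
locale unit_element = comm_group G for G (structure) +
  fixes e
  assumes e_closed [simp, intro]: "e \<in> carrier G"
    and e_pow_eq_one: "e [^] (m::int) = \<one> \<Longrightarrow> m = 0"
    and multiple_in_span: "x \<in> carrier G \<Longrightarrow> \<exists>(n::int) (m::int). 0 < n \<and> x [^] n = e [^] m"
    and divisible_mod_span:
      "\<lbrakk>x \<in> carrier G; 0 < (N::int)\<rbrakk> \<Longrightarrow> \<exists>b::int. \<exists>w\<in>carrier G. x = e [^] b \<otimes> w [^] N"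
    and reduced: "\<lbrakk>subgroup D G; divisible_group (G\<lparr>carrier := D\<rparr>);
      torsion_group (G\<lparr>carrier := D\<rparr>)\<rbrakk> \<Longrightarrow> D = {\<one>}"
begin

text \<open>
  Let \<open>T\<close> be the \<open>p\<close>-primary part, written additively. If \<open>T \<noteq> p T\<close>, then any \<open>t\<close> in \<open>T\<close> outside \<open>p T\<close>
  satisfies \<open>T = \<langle>t\<rangle> + p T\<close>: writing \<open>t = c e + p g\<close>, the coefficient \<open>c\<close> is prime to \<open>p\<close>, so
  \<open>e\<close>, and with it all of \<open>G\<close>, lies in \<open>\<langle>t\<rangle> + p G\<close>. Multiplying by the order \<open>p^k\<close> of \<open>t\<close> gives
  \<open>p^k T = p (p^k T)\<close>; thus \<open>p^k T\<close> is divisible and torsion, hence zero. If \<open>T = p T\<close>, the same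
  holds with \<open>k = 0\<close>.
\<close>
lemma primary_part_bounded:
  assumes p: "prime (p::nat)"
  obtains k where "\<And>s j. \<lbrakk>s \<in> carrier G; s [^] (int p ^ j) = \<one>\<rbrakk> \<Longrightarrow> s [^] (int p ^ k) = \<one>"
proof -
  define T where "T = {s \<in> carrier G. \<exists>j. s [^] (int p ^ j) = \<one>}"
  have T_closed: "s \<in> carrier G" if "s \<in> T" for s using that by (simp add: T_def)
  have T_sub: "subgroup T G"
  proof (rule subgroupI)
    show "T \<subseteq> carrier G" by (auto simp: T_def)
    show "T \<noteq> {}" by (force simp: T_def)
    show "inv s \<in> T" if "s \<in> T" for s using that by (auto simp: T_def int_pow_inv)
    show "s \<otimes> t \<in> T" if st: "s \<in> T" "t \<in> T" for s t
    proof -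
      have c: "s \<in> carrier G" "t \<in> carrier G" using st by (auto simp: T_def)
      obtain i j where ij: "s [^] (int p ^ i) = \<one>" "t [^] (int p ^ j) = \<one>"
        using st by (auto simp: T_def)
      have "(s \<otimes> t) [^] (int p ^ (i + j))
          = (s [^] (int p ^ i)) [^] (int p ^ j) \<otimes> (t [^] (int p ^ j)) [^] (int p ^ i)"
        using c by (simp add: int_pow_distrib int_pow_pow power_add mult.commute)
      also have "\<dots> = \<one>" by (simp add: ij)
      finally have "\<exists>k. (s \<otimes> t) [^] (int p ^ k) = \<one>" by blast
      then show ?thesis using c by (simp add: T_def)
    qed
  qed
  have T_pow: "s [^] (i::int) \<in> T" if "s \<in> T" for s i
    using T_sub that by (rule subgroup_int_pow_closed)
  \<comment> \<open>\<open>T\<close> is closed under extracting \<open>p\<close>-th roots, so roots found in \<open>G\<close> are available in \<open>T\<close>.\<close>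
  have T_root: "h \<in> T" if "h \<in> carrier G" "h [^] int p \<in> T" for h
  proof -
    obtain j where "(h [^] int p) [^] (int p ^ j) = \<one>" using \<open>h [^] int p \<in> T\<close> by (auto simp: T_def)
    then have "h [^] (int p ^ Suc j) = \<one>" using that by (simp add: int_pow_pow)
    then show ?thesis using that by (auto simp: T_def simp del: power_Suc)
  qed
  have stable: "\<exists>k. \<forall>s\<in>T. \<exists>h\<in>T. s [^] (int p ^ k) = (h [^] (int p ^ k)) [^] int p"
  proof (cases "\<forall>s\<in>T. \<exists>h\<in>T. s = h [^] int p")
    case True
    then show ?thesis by (intro exI[of _ 0]) (auto simp: T_closed)
  next
    case False
    then obtain t where t: "t \<in> T" and no_root: "\<And>h. h \<in> T \<Longrightarrow> t \<noteq> h [^] int p" by blast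
    obtain c g where g: "g \<in> carrier G" "t = e [^] (c::int) \<otimes> g [^] int p"
      using divisible_mod_span[of t "int p"] t T_closed prime_gt_0_nat[OF p] by auto
    have "\<not> int p dvd c"
    proof
      assume "int p dvd c"
      then obtain c' where c': "c = c' * int p" by (metis dvd_div_mult_self)
      have t_eq: "t = (e [^] c' \<otimes> g) [^] int p"
        unfolding g(2) c' using g(1) by (simp add: int_pow_distrib int_pow_pow)
      have "e [^] c' \<otimes> g \<in> T"
      proof (rule T_root)
        show "e [^] c' \<otimes> g \<in> carrier G" using g(1) by simp
        show "(e [^] c' \<otimes> g) [^] int p \<in> T" using t unfolding t_eq .
      qed
      with t_eq show False using no_root by blast
    qed
    then have "coprime c (int p)"
      using p by (metis coprime_commute prime_imp_coprime prime_nat_int_transfer)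
    then obtain u v where uv: "u * c + v * int p = 1"
      by (metis bezout_int coprime_iff_gcd_eq_1)
    \<comment> \<open>\<open>r\<close> is the correction term in \<open>e = u t + p r\<close>, read off from \<open>e = u c e + v p e\<close> and \<open>c e = t - p g\<close>.\<close>
    define r where "r = e [^] v \<otimes> inv (g [^] u)"
    have r: "r \<in> carrier G" using g by (simp add: r_def)
    have e_eq: "e = t [^] u \<otimes> r [^] int p"
    proof -
      have "t [^] u \<otimes> r [^] int p
          = (e [^] (c * u) \<otimes> g [^] (int p * u)) \<otimes> (e [^] (v * int p) \<otimes> inv (g [^] (u * int p)))"
        unfolding g(2) using g(1) by (simp add: r_def int_pow_distrib int_pow_pow int_pow_inv)
      also have "\<dots> = e [^] (c * u) \<otimes> e [^] (v * int p) \<otimes> (g [^] (int p * u) \<otimes> inv (g [^] (int p * u)))"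
        using g(1) by (simp add: m_ac mult.commute)
      also have "\<dots> = e [^] (u * c + v * int p)"
        using g(1) by (simp add: int_pow_mult mult.commute)
      finally show ?thesis by (simp add: uv)
    qed
    obtain k where k: "t [^] (int p ^ k) = \<one>" using t by (auto simp: T_def)
    have "\<exists>h\<in>T. s [^] (int p ^ k) = (h [^] (int p ^ k)) [^] int p" if s: "s \<in> T" for s
    proof -
      obtain b w where w: "w \<in> carrier G" "s = e [^] (b::int) \<otimes> w [^] int p"
        using divisible_mod_span[of s "int p"] s T_closed prime_gt_0_nat[OF p] by auto
      define h where "h = r [^] b \<otimes> w"
      have tc: "t \<in> carrier G" using t T_closed by blast
      have h: "h \<in> carrier G" using r w(1) by (simp add: h_def)
      have "s = (t [^] u \<otimes> r [^] int p) [^] b \<otimes> w [^] int p"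
        unfolding e_eq[symmetric] by (rule w(2))
      also have "\<dots> = t [^] (u * b) \<otimes> h [^] int p"
        using r w(1) tc by (simp add: h_def int_pow_distrib int_pow_pow m_ac mult.commute)
      finally have s_eq: "s = t [^] (u * b) \<otimes> h [^] int p" .
      have "h [^] int p = inv (t [^] (u * b)) \<otimes> s"
        unfolding s_eq using h tc by (simp add: m_assoc[symmetric])
      also have "\<dots> \<in> T"
        using T_sub s T_pow[OF t] by (simp add: subgroup.m_closed subgroup.m_inv_closed)
      finally have "h \<in> T" by (rule T_root[OF h])
      moreover have "s [^] (int p ^ k) = (t [^] (int p ^ k)) [^] (u * b) \<otimes> (h [^] (int p ^ k)) [^] int p"
        using h tc by (simp add: s_eq int_pow_distrib int_pow_pow mult.commute)
      then have "s [^] (int p ^ k) = (h [^] (int p ^ k)) [^] int p"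
        using h by (simp add: k)
      ultimately show ?thesis by blast
    qed
    then show ?thesis by blast
  qed
  then obtain k where k: "\<And>s. s \<in> T \<Longrightarrow> \<exists>h\<in>T. s [^] (int p ^ k) = (h [^] (int p ^ k)) [^] int p"
    by blast
  define D where "D = (\<lambda>s. s [^] (int p ^ k)) ` T"
  have D_sub: "subgroup D G"
  proof (rule subgroupI)
    show "D \<subseteq> carrier G" by (auto simp: D_def T_closed)
    show "D \<noteq> {}" using subgroup.one_closed[OF T_sub] by (auto simp: D_def)
    show "inv d \<in> D" if "d \<in> D" for d
      using that subgroup.m_inv_closed[OF T_sub]
      by (auto simp: D_def T_closed int_pow_inv[symmetric])
    show "c \<otimes> d \<in> D" if "c \<in> D" "d \<in> D" for c d
      using that subgroup.m_closed[OF T_sub]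
      by (auto simp: D_def T_closed int_pow_distrib[symmetric])
  qed
  have "D \<subseteq> T" by (auto simp: D_def T_pow)
  then have "D = {\<one>}"
    using k by (intro reduced D_sub divisible_torsion_subgroupI[OF D_sub p]) (auto simp: D_def T_def)
  then have "s [^] (int p ^ k) = \<one>" if "s \<in> T" for s
    using that by (auto simp: D_def)
  then show thesis by (intro that[of k]) (auto simp: T_def)
qed

text \<open>
  For an element of prime order \<open>p\<close> that is \<open>p^k\<close> times some \<open>w\<close>, the element \<open>w\<close> is itself \<open>p\<close>-primary
  and hence killed by \<open>p^k\<close> once \<open>k\<close> bounds the \<open>p\<close>-primary part. The general case strips off one
  prime factor of the order at a time.
\<close>
lemma torsion_infinite_height_eq_one:
  assumes "t \<in> carrier G" "0 < n" "t [^] int n = \<one>"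
    and "\<And>N::int. 0 < N \<Longrightarrow> \<exists>w\<in>carrier G. t = w [^] N"
  shows "t = \<one>"
  using assms
proof (induction n arbitrary: t rule: less_induct)
  case (less n)
  show ?case
  proof (cases "n = 1")
    case True
    then show ?thesis using less.prems by simp
  next
    case False
    then obtain p where p: "prime p" "p dvd n" by (metis prime_factor_nat)
    then obtain m where m: "n = m * p" by (metis dvd_div_mult_self)
    have "m < n" "0 < m" using m less.prems(2) prime_gt_1_nat[OF p(1)] by auto
    obtain k where k: "\<And>s j. \<lbrakk>s \<in> carrier G; s [^] (int p ^ j) = \<one>\<rbrakk> \<Longrightarrow> s [^] (int p ^ k) = \<one>"
      using primary_part_bounded[OF p(1)] by blast
    obtain w where w: "w \<in> carrier G" "t = w [^] (int p ^ k)"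
      using less.prems(4)[of "int p ^ k"] prime_gt_0_nat[OF p(1)] by auto
    have "(w [^] int m) [^] (int p ^ Suc k) = t [^] int n"
      using w by (simp add: int_pow_pow m mult_ac)
    then have "(w [^] int m) [^] (int p ^ k) = \<one>"
      using w less.prems(3) by (intro k[of _ "Suc k"]) (auto simp del: power_Suc)
    then have "t [^] int m = \<one>" using w by (simp add: int_pow_pow mult.commute)
    then show ?thesis using less.IH[OF \<open>m < n\<close>] \<open>0 < m\<close> less.prems by blast
  qed
qed


section \<open>The multiplication with identity \<open>e\<close>\<close>

text \<open>Congruence modulo the subgroup of \<open>N\<close>-th powers, that is, modulo \<open>N G\<close> in additive notation.\<close>
definition congr :: "int \<Rightarrow> 'a \<Rightarrow> 'a \<Rightarrow> bool" where
  "congr N x y \<longleftrightarrow> x \<in> carrier G \<and> y \<in> carrier G \<and> (\<exists>w\<in>carrier G. x = y \<otimes> w [^] N)"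

lemma congr_refl: "x \<in> carrier G \<Longrightarrow> congr N x x"
  unfolding congr_def by (intro conjI bexI[of _ \<one>]) auto

lemma congr_sym: "congr N x y \<Longrightarrow> congr N y x"
  unfolding congr_def
  by (elim conjE bexE, intro conjI, simp, simp, rule_tac x = "inv w" in bexI)
    (auto simp: int_pow_inv m_assoc)

lemma congr_mult:
  assumes "congr N x y" "congr N x' y'" shows "congr N (x \<otimes> x') (y \<otimes> y')"
proof -
  obtain w w' where "w \<in> carrier G" "w' \<in> carrier G" "x = y \<otimes> w [^] N" "x' = y' \<otimes> w' [^] N"
    using assms by (auto simp: congr_def)
  then show ?thesis using assms unfolding congr_def
    by (intro conjI bexI[of _ "w \<otimes> w'"]) (auto simp: int_pow_distrib m_ac)
qed

lemma congr_trans [trans]: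
  assumes "congr N x y" "congr N y z" shows "congr N x z"
proof -
  obtain w w' where "w \<in> carrier G" "w' \<in> carrier G" "x = y \<otimes> w [^] N" "y = z \<otimes> w' [^] N"
    using assms by (auto simp: congr_def)
  then show ?thesis using assms unfolding congr_def
    by (intro conjI bexI[of _ "w' \<otimes> w"]) (auto simp: int_pow_distrib m_ac)
qed

lemma congr_pow:
  assumes "congr N x y" shows "congr N (x [^] (k::int)) (y [^] k)"
proof -
  obtain w where "w \<in> carrier G" "x = y \<otimes> w [^] N"
    using assms by (auto simp: congr_def)
  then show ?thesis using assms unfolding congr_def
    by (intro conjI bexI[of _ "w [^] k"]) (auto simp: int_pow_distrib int_pow_pow mult.commute)
qed

lemma congr_hom:
  assumes "\<phi> \<in> hom G G" "congr N x y" shows "congr N (\<phi> x) (\<phi> y)"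
proof -
  interpret \<phi>: group_hom G G \<phi> using assms(1) by unfold_locales
  show ?thesis using assms(2) unfolding congr_def by (auto simp: \<phi>.hom_int_pow)
qed

lemma congr_span:
  assumes "x \<in> carrier G" "0 < N"
  obtains b :: int where "congr N x (e [^] b)"
  using divisible_mod_span[OF assms] assms(1) unfolding congr_def by auto

text \<open>
  Although \<open>e\<close> need not have the same order modulo \<open>N\<close>-th powers as \<open>x\<close>, its order is a multiple of
  that of \<open>x\<close>, because \<open>x\<close> is congruent to a power of \<open>e\<close>. So the residue that describes an element
  acts unambiguously on \<open>x\<close>.
\<close>
lemma congr_exponent:
  assumes x: "x \<in> carrier G" and N: "0 < N" and e: "congr N (e [^] (a::int)) (e [^] (c::int))"
  shows "congr N (x [^] a) (x [^] c)"
proof -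
  obtain b where b: "congr N x (e [^] (b::int))" using x N by (rule congr_span)
  have "congr N (x [^] a) ((e [^] a) [^] b)"
    using congr_pow[OF b, of a] by (simp add: int_pow_pow mult.commute)
  also have "congr N \<dots> ((e [^] c) [^] b)" using e by (rule congr_pow)
  also have "congr N \<dots> (x [^] c)"
    using congr_sym[OF congr_pow[OF b, of c]] by (simp add: int_pow_pow mult.commute)
  finally show ?thesis .
qed

text \<open>
  The first condition determines \<open>z\<close> up to torsion, the second one up to elements of infinite height;
  either of them alone may have several solutions. The asymmetry is deliberate: for fixed \<open>y\<close>,
  both conditions are visibly additive in \<open>x\<close> and \<open>z\<close>, and the set of admissible \<open>a\<close> depends on \<open>y\<close> only.
\<close>
definition is_product :: "'a \<Rightarrow> 'a \<Rightarrow> 'a \<Rightarrow> bool" where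
  "is_product x y z \<longleftrightarrow> z \<in> carrier G \<and>
     (\<exists>(n::int) (m::int). 0 < n \<and> x [^] n = e [^] m \<and> z [^] n = y [^] m) \<and>
     (\<forall>N (a::int). 0 < N \<longrightarrow> congr N y (e [^] a) \<longrightarrow> congr N z (x [^] a))"

lemma is_product_unique:
  assumes x: "x \<in> carrier G" and y: "y \<in> carrier G"
    and z1: "is_product x y z1" and z2: "is_product x y z2"
  shows "z1 = z2"
proof -
  have z: "z1 \<in> carrier G" "z2 \<in> carrier G" using z1 z2 by (auto simp: is_product_def)
  obtain n1 m1 :: int where 1: "0 < n1" "x [^] n1 = e [^] m1" "z1 [^] n1 = y [^] m1"
    using z1 by (auto simp: is_product_def)
  obtain n2 m2 :: int where 2: "0 < n2" "x [^] n2 = e [^] m2" "z2 [^] n2 = y [^] m2"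
    using z2 by (auto simp: is_product_def)
  \<comment> \<open>The fraction \<open>m / n\<close> attached to \<open>x\<close> is well defined because \<open>e\<close> has infinite order.\<close>
  have "e [^] (m1 * n2) = (x [^] n1) [^] n2" by (simp add: 1 int_pow_pow)
  also have "\<dots> = (x [^] n2) [^] n1" using x by (simp add: int_pow_pow mult.commute)
  also have "\<dots> = e [^] (m2 * n1)" by (simp add: 2 int_pow_pow)
  finally have "e [^] (m1 * n2 - m2 * n1) = \<one>" by (simp add: int_pow_diff)
  then have m: "m1 * n2 = m2 * n1" using e_pow_eq_one by fastforce
  have "z1 [^] (n1 * n2) = (z1 [^] n1) [^] n2" using z by (simp add: int_pow_pow)
  also have "\<dots> = y [^] (m1 * n2)" using y by (simp add: 1 int_pow_pow)
  also have "\<dots> = (z2 [^] n2) [^] n1" using y by (simp add: 2 m int_pow_pow)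
  also have "\<dots> = z2 [^] (n1 * n2)" using z by (simp add: int_pow_pow mult.commute)
  finally have eq: "z1 [^] (n1 * n2) = z2 [^] (n1 * n2)" .
  have "z1 \<otimes> inv z2 = \<one>"
  proof (rule torsion_infinite_height_eq_one)
    show "z1 \<otimes> inv z2 \<in> carrier G" using z by simp
    show "0 < nat (n1 * n2)" using 1 2 by simp
    show "(z1 \<otimes> inv z2) [^] int (nat (n1 * n2)) = \<one>"
      using 1(1) 2(1) z by (simp add: int_pow_distrib int_pow_inv eq)
    fix N :: int assume N: "0 < N"
    obtain a where a: "congr N y (e [^] (a::int))" using y N by (rule congr_span)
    have "congr N z1 (x [^] a)" "congr N z2 (x [^] a)"
      using z1 z2 a N by (auto simp: is_product_def)
    then have "congr N z1 z2" using congr_sym congr_trans by blast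
    then obtain w where w: "w \<in> carrier G" "z1 = z2 \<otimes> w [^] N" by (auto simp: congr_def)
    have "z1 \<otimes> inv z2 = w [^] N"
      unfolding w(2) using w(1) z(2) by (simp add: m_comm[of z2] m_assoc)
    with w(1) show "\<exists>w\<in>carrier G. z1 \<otimes> inv z2 = w [^] N" by blast
  qed
  then show ?thesis using inv_equality[of z1 "inv z2"] z by simp
qed

text \<open>
  Additively, with \<open>n x = m e\<close> and \<open>y = k e + n v\<close> the product should be
  \<open>k x + n x v = k x + m e v = k x + m v\<close>, which makes sense in the group alone.
\<close>
lemma is_product_exists:
  assumes x: "x \<in> carrier G" and y: "y \<in> carrier G"
  shows "\<exists>z. is_product x y z"
proof -
  obtain n m :: int where n: "0 < n" "x [^] n = e [^] m" using multiple_in_span[OF x] by blast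
  obtain k :: int and v where v: "v \<in> carrier G" "y = e [^] k \<otimes> v [^] n"
    using divisible_mod_span[OF y n(1)] by blast
  define z where "z = v [^] m \<otimes> x [^] k"
  have "z [^] n = (v [^] n) [^] m \<otimes> (x [^] n) [^] k"
    using v x by (simp add: z_def int_pow_distrib int_pow_pow mult.commute)
  also have "\<dots> = y [^] m"
    using v by (simp add: n(2) int_pow_distrib int_pow_pow m_comm mult.commute)
  finally have z_pow: "z [^] n = y [^] m" .
  have "congr N z (x [^] a)" if N: "0 < N" and a: "congr N y (e [^] a)" for N and a :: int
  proof -
    \<comment> \<open>\<open>y\<close> and \<open>z\<close> are computed modulo \<open>N\<close> from one residue \<open>c\<close> of \<open>v\<close>; then \<open>k + n c\<close> is a residue of \<open>y\<close>
      with the required property, and any other residue \<open>a\<close> acts in the same way on \<open>x\<close>.\<close>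
    obtain c where c: "congr N v (e [^] (c::int))" using v(1) N by (rule congr_span)
    have "congr N y (e [^] k \<otimes> (e [^] c) [^] n)"
      unfolding v(2) by (intro congr_mult congr_refl congr_pow c) simp
    also have "e [^] k \<otimes> (e [^] c) [^] n = e [^] (k + n * c)"
      by (simp add: int_pow_pow int_pow_mult mult.commute)
    finally have "congr N (e [^] (k + n * c)) (e [^] a)"
      using a by (blast intro: congr_sym congr_trans)
    then have xa: "congr N (x [^] (k + n * c)) (x [^] a)"
      by (rule congr_exponent[OF x N])
    have "congr N z ((e [^] c) [^] m \<otimes> x [^] k)"
      unfolding z_def by (intro congr_mult congr_refl congr_pow c) (use x in simp)
    also have "(e [^] c) [^] m = (x [^] n) [^] c"
      by (simp add: n(2) int_pow_pow mult.commute)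
    also have "(x [^] n) [^] c \<otimes> x [^] k = x [^] (k + n * c)"
      using x by (simp add: int_pow_pow int_pow_mult m_comm)
    also note xa
    finally show ?thesis .
  qed
  then have "is_product x y z"
    using n z_pow v x by (auto simp: is_product_def z_def)
  then show ?thesis ..
qed

definition product :: "'a \<Rightarrow> 'a \<Rightarrow> 'a" where
  "product x y = (THE z. is_product x y z)"

lemma product_eqI:
  "\<lbrakk>x \<in> carrier G; y \<in> carrier G; is_product x y z\<rbrakk> \<Longrightarrow> product x y = z"
  unfolding product_def using is_product_unique by blast

lemma is_product_product: "\<lbrakk>x \<in> carrier G; y \<in> carrier G\<rbrakk> \<Longrightarrow> is_product x y (product x y)"
  using is_product_exists product_eqI by metis

lemma product_hom:
  assumes y: "y \<in> carrier G" shows "(\<lambda>x. product x y) \<in> hom G G"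
proof (rule homI)
  show "product x y \<in> carrier G" if "x \<in> carrier G" for x
    using is_product_product[OF that y] by (simp add: is_product_def)
  fix x1 x2 assume x: "x1 \<in> carrier G" "x2 \<in> carrier G"
  define z1 z2 where z_def: "z1 = product x1 y" "z2 = product x2 y"
  have z: "is_product x1 y z1" "is_product x2 y z2"
    unfolding z_def using x y by (auto intro: is_product_product)
  then have zc: "z1 \<in> carrier G" "z2 \<in> carrier G" by (auto simp: is_product_def)
  have "is_product (x1 \<otimes> x2) y (z1 \<otimes> z2)"
    unfolding is_product_def
  proof (intro conjI allI impI)
    show "z1 \<otimes> z2 \<in> carrier G" using zc by simp
    obtain n1 m1 :: int where 1: "0 < n1" "x1 [^] n1 = e [^] m1" "z1 [^] n1 = y [^] m1"
      using z by (auto simp: is_product_def)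
    obtain n2 m2 :: int where 2: "0 < n2" "x2 [^] n2 = e [^] m2" "z2 [^] n2 = y [^] m2"
      using z by (auto simp: is_product_def)
    have expand: "(u \<otimes> v) [^] (n1 * n2) = (u [^] n1) [^] n2 \<otimes> (v [^] n2) [^] n1"
      if "u \<in> carrier G" "v \<in> carrier G" for u v
      using that by (simp add: int_pow_distrib int_pow_pow mult.commute)
    have "(x1 \<otimes> x2) [^] (n1 * n2) = e [^] (m1 * n2 + m2 * n1)"
      using x by (simp add: expand 1 2 int_pow_pow int_pow_mult)
    moreover have "(z1 \<otimes> z2) [^] (n1 * n2) = y [^] (m1 * n2 + m2 * n1)"
      using zc y by (simp add: expand 1 2 int_pow_pow int_pow_mult)
    moreover have "0 < n1 * n2" using 1(1) 2(1) by simp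
    ultimately show "\<exists>(n::int) (m::int). 0 < n \<and> (x1 \<otimes> x2) [^] n = e [^] m \<and> (z1 \<otimes> z2) [^] n = y [^] m"
      by blast
    show "congr N (z1 \<otimes> z2) ((x1 \<otimes> x2) [^] a)" if "0 < N" "congr N y (e [^] a)" for N and a :: int
      using that z x by (auto simp: is_product_def int_pow_distrib intro!: congr_mult)
  qed
  then show "product (x1 \<otimes> x2) y = product x1 y \<otimes> product x2 y"
    using x y by (auto simp: z_def intro: product_eqI)
qed

lemma product_left_unit:
  assumes y: "y \<in> carrier G" shows "product e y = y"
proof (rule product_eqI[OF e_closed y])
  show "is_product e y y"
    unfolding is_product_def using y by (intro conjI exI[of _ "1::int"]) auto
qed

text \<open>
  An endomorphism preserves powers and congruences, so it transports the two descriptions of \<open>x\<close> in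
  terms of \<open>e\<close> to descriptions of \<open>\<phi> x\<close> in terms of \<open>\<phi> e\<close>, and these characterise the product.
\<close>
lemma hom_eq_product:
  assumes \<phi>: "\<phi> \<in> hom G G" and x: "x \<in> carrier G"
  shows "\<phi> x = product x (\<phi> e)"
proof -
  interpret \<phi>: group_hom G G \<phi> using \<phi> by unfold_locales
  have "is_product x (\<phi> e) (\<phi> x)"
    unfolding is_product_def
  proof (intro conjI allI impI)
    show "\<phi> x \<in> carrier G" using x by simp
    obtain n m :: int where "0 < n" "x [^] n = e [^] m" using multiple_in_span[OF x] by blast
    moreover from this have "\<phi> x [^] n = \<phi> e [^] m"
      using x by (metis \<phi>.hom_int_pow e_closed)
    ultimately show "\<exists>(n::int) (m::int). 0 < n \<and> x [^] n = e [^] m \<and> \<phi> x [^] n = \<phi> e [^] m" by blast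
    fix N and a :: int assume N: "0 < N" and a: "congr N (\<phi> e) (e [^] a)"
    obtain b where b: "congr N x (e [^] (b::int))" using x N by (rule congr_span)
    have "congr N (\<phi> x) (\<phi> e [^] b)" using congr_hom[OF \<phi> b] by (simp add: \<phi>.hom_int_pow)
    also have "congr N \<dots> ((e [^] a) [^] b)" using a by (rule congr_pow)
    also have "congr N \<dots> (x [^] a)"
      using congr_sym[OF congr_pow[OF b, of a]] by (simp add: int_pow_pow mult.commute)
    finally show "congr N (\<phi> x) (x [^] a)" .
  qed
  then show ?thesis using x by (auto intro: product_eqI[symmetric])
qed

text \<open>
  Additivity in the second factor: the pointwise sum of multiplication by \<open>y\<close> and by \<open>y'\<close> is an
  endomorphism with value \<open>y + y'\<close> at the identity, so it is multiplication by \<open>y + y'\<close>.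
\<close>
lemma biadditive_product: "biadditive G product"
  unfolding biadditive_def
proof (intro conjI ballI product_hom)
  fix x assume x: "x \<in> carrier G"
  have closed: "product u v \<in> carrier G" if "u \<in> carrier G" "v \<in> carrier G" for u v
    using product_hom[OF that(2)] that(1) by (auto simp: hom_def)
  show "product x \<in> hom G G"
  proof (rule homI)
    show "product x y \<in> carrier G" if "y \<in> carrier G" for y using closed x that .
    fix y y' assume y: "y \<in> carrier G" "y' \<in> carrier G"
    have "(\<lambda>u. product u y \<otimes> product u y') \<in> hom G G"
      using product_hom[OF y(1)] product_hom[OF y(2)] by (rule hom_group_mult)
    from hom_eq_product[OF this x] show "product x (y \<otimes> y') = product x y \<otimes> product x y'"
      using y by (simp add: product_left_unit)
  qed
qed

end


section \<open>Ideals, absolute ideals and fully invariant subgroups\<close>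

text \<open>In any ring, left and right multiplication by a fixed element are endomorphisms of the group.\<close>
lemma fully_invariant_imp_absolute_ideal:
  assumes "comm_group G" "fully_invariant G A"
  shows "absolute_ideal G A"
proof -
  have "ring_ideal G \<mu> A" if "\<mu> \<in> multiplications G" for \<mu>
    using biadditive_times_of[OF assms(1) that] assms(2)
    unfolding ring_ideal_def biadditive_def fully_invariant_def
    by (auto simp: image_subset_iff)
  then show ?thesis using assms(2) by (simp add: absolute_ideal_def fully_invariant_def)
qed

context unit_element
begin

text \<open>
  Conversely, in the ring constructed above every endomorphism is multiplication by an element, so
  that all ideals are fully invariant.
\<close>
lemma FI_ring_obtain:
  obtains \<mu> where "\<mu> \<in> multiplications G"
    "\<And>I. ring_ideal G \<mu> I \<Longrightarrow> fully_invariant G I"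
proof -
  obtain \<mu> where \<mu>: "\<mu> \<in> multiplications G"
    and eq: "\<And>x y. \<lbrakk>x \<in> carrier G; y \<in> carrier G\<rbrakk> \<Longrightarrow> times_of G \<mu> x y = product x y"
    by (rule biadditive_imp_multiplication[OF comm_group_axioms biadditive_product]) (rule that)
  have "fully_invariant G I" if I: "ring_ideal G \<mu> I" for I
    unfolding fully_invariant_def
  proof (intro conjI ballI image_subsetI)
    show "subgroup I G" using I by (simp add: ring_ideal_def)
    fix \<phi> x assume \<phi>: "\<phi> \<in> hom G G" and x: "x \<in> I"
    have xc: "x \<in> carrier G" using \<open>subgroup I G\<close> x by (rule subgroup.mem_carrier)
    have "\<phi> e \<in> carrier G" using \<phi> by (auto simp: hom_def)
    then have "product x (\<phi> e) \<in> I"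
      using I x xc unfolding ring_ideal_def by (metis eq)
    then show "\<phi> x \<in> I" using hom_eq_product[OF \<phi> xc] by simp
  qed
  with \<mu> show thesis by (rule that)
qed

end


section \<open>Quotient divisible groups of rank one\<close>

text \<open>
  The rank \<open>n\<close> of \<open>F\<close> is 1: with \<open>n = 0\<close> the group would be torsion and so have no nonempty independent
  set, while for \<open>n \<ge> 2\<close> two basis elements of \<open>F\<close> would be independent in \<open>G\<close>.
\<close>
lemma (in comm_group) rank_one_free_subgroup_generator:
  assumes F: "subgroup F G" and free: "free_of_rank (G\<lparr>carrier := F\<rparr>) n"
    and tors: "torsion_group (G Mod F)" and rank: "torsion_free_rank G = 1"
  obtains e where "e \<in> carrier G" "F = range (\<lambda>m::int. e [^] m)" "\<And>m::int. e [^] m = \<one> \<Longrightarrow> m = 0"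
proof -
  interpret F: subgroup F G by fact
  interpret GF: group "G\<lparr>carrier := F\<rparr>" by (rule F.subgroup_is_group) (rule is_group)
  interpret FN: normal F G by (rule subgroup_imp_normal[OF F])
  have le_one: "card S \<le> 1" if "int_independent G S" for S
  proof -
    have "enat (card S) \<le> torsion_free_rank G"
      unfolding torsion_free_rank_def using that by (intro SUP_upper) simp
    then show ?thesis by (simp add: rank one_enat_def)
  qed
  obtain f where f: "f \<in> iso (free_Abelian_group {..<n}) (G\<lparr>carrier := F\<rparr>)"
    using free unfolding free_of_rank_def is_iso_def by (metis GF.iso_set_sym ex_in_conv)
  interpret f: group_hom "free_Abelian_group {..<n}" "G\<lparr>carrier := F\<rparr>" f
    using f by (intro group_hom.intro group_hom_axioms.intro) (auto simp: iso_def GF.is_group)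
  have f_pow: "f (frag_cmul m a) = f a [^] m" if "Poly_Mapping.keys a \<subseteq> {..<n}" for a and m :: int
    using f.hom_int_pow[of a m] that int_pow_consistent[OF F, of "f a" m] f.hom_closed[of a] by simp
  have f_eq_one: "a = 0" if "Poly_Mapping.keys a \<subseteq> {..<n}" "f a = \<one>" for a
    using f that f.hom_one by (auto simp: iso_def bij_betw_def inj_on_def)
  have f_im: "f ` {a. Poly_Mapping.keys a \<subseteq> {..<n}} = F"
    using f by (auto simp: iso_def bij_betw_def free_Abelian_group_def)
  have fF: "f a \<in> carrier G" if "Poly_Mapping.keys a \<subseteq> {..<n}" for a
    using f.hom_closed[of a] that F.mem_carrier by simp
  have "n \<noteq> 0"
  proof
    assume "n = 0"
    then have F1: "F = {\<one>}" using f_im f.hom_one by auto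
    have tor: "\<exists>k::nat. 0 < k \<and> x [^] k = \<one>" if x: "x \<in> carrier G" for x
    proof -
      have "F #> x \<in> carrier (G Mod F)" using x by (auto simp: FactGroup_def RCOSETS_def)
      then obtain k :: nat where k: "0 < k" "(F #> x) [^]\<^bsub>G Mod F\<^esub> k = \<one>\<^bsub>G Mod F\<^esub>"
        using tors unfolding torsion_group_def by blast
      then have "F #> (x [^] k) = F" using FN.FactGroup_pow[OF x] by simp
      then have "x [^] k \<in> F" using x rcos_self[OF _ F, of "x [^] k"] by simp
      then show ?thesis using k F1 by auto
    qed
    have "card S = 0" if S: "int_independent G S" for S
    proof (rule ccontr)
      assume "card S \<noteq> 0"
      then obtain x where x: "x \<in> S" by fastforce
      then have "x \<in> carrier G" using S by (auto simp: int_independent_def)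
      then obtain k :: nat where k: "0 < k" "x [^] k = \<one>" using tor by blast
      have "finprod G (\<lambda>y. y [^] (if y = x then int k else 0)) S = finprod G (\<lambda>y. \<one>) S"
        using S k by (intro finprod_cong) (auto simp: int_pow_int int_independent_def simp_implies_def)
      then have "finprod G (\<lambda>y. y [^] (if y = x then int k else 0)) S = \<one>" by simp
      then have "\<forall>y\<in>S. (if y = x then int k else 0) = 0"
        using S[unfolded int_independent_def, THEN conjunct2, THEN conjunct2,
            THEN spec[of _ "\<lambda>y. if y = x then int k else 0"]] by simp
      then show False using x k by auto
    qed
    then have "torsion_free_rank G \<le> 0"
      unfolding torsion_free_rank_def by (intro SUP_least) (auto simp: zero_enat_def)
    then show False by (simp add: rank)
  qed
  moreover have "\<not> 2 \<le> n"
  proof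
    assume n: "2 \<le> n"
    have keys: "Poly_Mapping.keys (frag_of (0::nat)) \<subseteq> {..<n}" "Poly_Mapping.keys (frag_of (1::nat)) \<subseteq> {..<n}"
      using n by auto
    define u v where uv: "u = f (frag_of 0)" "v = f (frag_of 1)"
    have uvc: "u \<in> carrier G" "v \<in> carrier G" using keys fF by (auto simp: uv)
    have indep: "i = 0 \<and> j = 0" if ij: "u [^] i \<otimes> v [^] j = \<one>" for i j :: int
    proof -
      let ?a = "frag_cmul i (frag_of 0) + frag_cmul j (frag_of (1::nat))"
      have sub: "Poly_Mapping.keys (frag_cmul i (frag_of (0::nat))) \<subseteq> {..<n}"
        "Poly_Mapping.keys (frag_cmul j (frag_of (1::nat))) \<subseteq> {..<n}"
        using n keys_cmul[of i "frag_of (0::nat)"] keys_cmul[of j "frag_of (1::nat)"] by auto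
      then have "f ?a = u [^] i \<otimes> v [^] j"
        using f.hom_mult[of "frag_cmul i (frag_of 0)" "frag_cmul j (frag_of 1)"] keys f_pow by (simp add: uv)
      then have "f ?a = \<one>" using ij by simp
      moreover have "Poly_Mapping.keys ?a \<subseteq> {..<n}"
        using keys_add[of "frag_cmul i (frag_of 0)" "frag_cmul j (frag_of (1::nat))"] sub
        by (meson Un_least order_trans)
      ultimately have a: "?a = 0" by (intro f_eq_one)
      have "Poly_Mapping.lookup ?a 0 = i" "Poly_Mapping.lookup ?a 1 = j"
        by (simp_all add: lookup_add del: single_one)
      then show ?thesis unfolding a by simp
    qed
    have "u \<noteq> v"
    proof
      assume "u = v"
      then have "u [^] (1::int) \<otimes> v [^] (-1::int) = \<one>" using uvc by (simp add: int_pow_neg)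
      then show False using indep[of 1 "-1"] by simp
    qed
    then have "int_independent G {u, v}"
      unfolding int_independent_def
    proof (intro conjI allI impI)
      fix c :: "'a \<Rightarrow> int" assume "finprod G (\<lambda>x. x [^] c x) {u, v} = \<one>"
      then have "u [^] c u \<otimes> v [^] c v = \<one>" using uvc \<open>u \<noteq> v\<close> by simp
      then show "\<forall>x\<in>{u, v}. c x = 0" using indep by blast
    qed (use uvc in auto)
    from le_one[OF this] show False using \<open>u \<noteq> v\<close> by simp
  qed
  ultimately have n: "n = 1" by simp
  let ?e = "f (frag_of 0)"
  have key: "Poly_Mapping.keys (frag_of (0::nat)) \<subseteq> {..<n}" using n by simp
  show thesis
  proof (rule that[of ?e])
    show "?e \<in> carrier G" using key by (rule fF)
    show "m = 0" if "?e [^] m = \<one>" for m :: int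
    proof -
      have "frag_cmul m (frag_of (0::nat)) = 0"
        using that key keys_cmul[of m "frag_of (0::nat)"] by (intro f_eq_one) (auto simp: f_pow)
      then show ?thesis by (simp add: frag_cmul_eq_0_iff)
    qed
    have "a = frag_cmul (Poly_Mapping.lookup a 0) (frag_of 0)" if "Poly_Mapping.keys a \<subseteq> {..<n}" for a
    proof (rule poly_mapping_eqI)
      show "Poly_Mapping.lookup a k = Poly_Mapping.lookup (frag_cmul (Poly_Mapping.lookup a 0) (frag_of 0)) k" for k
        using that n by (cases "k = 0") (auto simp: in_keys_iff subset_iff simp del: single_one)
    qed
    then have "f a \<in> range (\<lambda>m::int. ?e [^] m)" if "Poly_Mapping.keys a \<subseteq> {..<n}" for a
      using that f_pow[OF key] by (metis rangeI)
    moreover have "?e [^] m \<in> F" for m :: int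
      using key f_im by (intro subgroup_int_pow_closed[OF F]) blast
    ultimately show "F = range (\<lambda>m::int. ?e [^] m)" using f_im by blast
  qed
qed

text \<open>Translation of the hypotheses from the quotient group \<open>G / F\<close> to elements of \<open>G\<close>.\<close>
lemma quotient_divisible_rank_one_unit_element:
  fixes G (structure)
  assumes "comm_group G" "quotient_divisible G" "torsion_free_rank G = 1"
  obtains e where "unit_element G e"
proof -
  interpret comm_group G by fact
  obtain F n where F: "subgroup F G" "free_of_rank (G\<lparr>carrier := F\<rparr>) n"
    and div: "divisible_group (G Mod F)" and tors: "torsion_group (G Mod F)"
    using assms(2) unfolding quotient_divisible_def by blast
  obtain e where e: "e \<in> carrier G" "F = range (\<lambda>m::int. e [^] m)" "\<And>m::int. e [^] m = \<one> \<Longrightarrow> m = 0"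
    by (rule rank_one_free_subgroup_generator[OF F tors assms(3)]) (rule that)
  interpret F: normal F G by (rule subgroup_imp_normal[OF F(1)])
  have coset: "F #> x \<in> carrier (G Mod F)" if "x \<in> carrier G" for x
    using that by (auto simp: FactGroup_def RCOSETS_def)
  have "unit_element G e"
  proof
    show "e \<in> carrier G" by fact
    show "m = 0" if "e [^] m = \<one>" for m :: int using that by (rule e(3))
    show "D = {\<one>}" if "subgroup D G" "divisible_group (G\<lparr>carrier := D\<rparr>)"
      "torsion_group (G\<lparr>carrier := D\<rparr>)" for D
      using assms(2) that unfolding quotient_divisible_def by blast
    fix x assume x: "x \<in> carrier G"
    obtain k :: nat where k: "0 < k" "(F #> x) [^]\<^bsub>G Mod F\<^esub> k = \<one>\<^bsub>G Mod F\<^esub>"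
      using tors coset[OF x] unfolding torsion_group_def by blast
    then have "F #> (x [^] k) = F" using F.FactGroup_pow[OF x] by simp
    then have "x [^] k \<in> F" using x rcos_self[OF _ F(1), of "x [^] k"] by simp
    then obtain m :: int where "x [^] int k = e [^] m" by (auto simp: e(2) int_pow_int)
    then show "\<exists>(n::int) (m::int). 0 < n \<and> x [^] n = e [^] m"
      using k(1) by (metis of_nat_0_less_iff)
    fix N :: int assume N: "0 < N"
    then obtain M :: nat where M: "N = int M" "0 < M" using zero_less_imp_eq_int by blast
    obtain Y where Y: "Y \<in> carrier (G Mod F)" "Y [^]\<^bsub>G Mod F\<^esub> M = F #> x"
      using div coset[OF x] M(2) unfolding divisible_group_def by blast
    then obtain w where w: "w \<in> carrier G" "Y = F #> w"
      by (auto simp: FactGroup_def RCOSETS_def)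
    have "F #> (w [^] M) = F #> x" using Y w F.FactGroup_pow[OF w(1)] by simp
    then have "x \<in> F #> (w [^] M)" using rcos_self[OF x F(1)] by simp
    then obtain b :: int where "x = e [^] b \<otimes> w [^] M"
      by (auto simp: r_coset_def e(2))
    then have "x = e [^] b \<otimes> w [^] N" by (simp add: M(1) int_pow_int)
    then show "\<exists>b::int. \<exists>w\<in>carrier G. x = e [^] b \<otimes> w [^] N"
      using w(1) by auto
  qed
  then show thesis by (rule that)
qed

theorem corollary3p2:
  fixes G :: "('a, 'm) monoid_scheme"
  assumes "comm_group G"
    and "quotient_divisible G"
    and "torsion_free_rank G = 1"
  shows "RAI_group G \<and> RFI_group G \<and> afi_group G"
proof -
  obtain e where "unit_element G e"
    by (rule quotient_divisible_rank_one_unit_element[OF assms])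
  then interpret unit_element G e .
  obtain \<mu> where \<mu>: "\<mu> \<in> multiplications G"
    and fi: "\<And>I. ring_ideal G \<mu> I \<Longrightarrow> fully_invariant G I"
    by (rule FI_ring_obtain) (rule that)
  have "FI_ring G \<mu>" unfolding FI_ring_def using \<mu> fi by simp
  moreover have "AI_ring G \<mu>"
    unfolding AI_ring_def
    using \<mu> fully_invariant_imp_absolute_ideal[OF assms(1) fi] by simp
  moreover have "fully_invariant G A" if "absolute_ideal G A" for A
    using that \<mu> unfolding absolute_ideal_def by (intro fi) simp
  then have "afi_group G" unfolding afi_group_def by simp
  ultimately show ?thesis unfolding RAI_group_def RFI_group_def by (intro conjI exI)
qed

end
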